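(* Let $\alpha,\beta\ge 1$. For the problem of scheduling with uncertain processing times on a single machine with the objective of minimizing the total completion time, the competitive ratio of the algorithm $(\alpha,\beta)$-SORT is at most $$\max\left\{\alpha\left(1+\tfrac1\beta\right),\ 1+\tfrac1\alpha+\tfrac1\beta,\ 1+\beta,\ 2,\ 1+\tfrac2\alpha\right\}.$$
   Context: Problem. There are $n$ jobs, all available at time $0$. Job $j$ has a testing time $t_j\ge 0$, an upper limit $u_j\ge 0$, and a real processing time $p_j\in[0,u_j]$. A job may be executed untested, which takes $u_j$ time units, or it may be tested (taking $t_j$ time units) and later executed in $p_j$ time units; other tasks may run between the test and the execution. The tasks regarding $j$ are its testing, its execution (after testing), or its execution-untested. A single machine runs one task at a time. The completion time of a job is the time at which its execution (or execution-untested) ends, and the cost of a schedule is the sum of the completion times of all jobs. An online algorithm knows all $t_j,u_j$ from the start, but learns $p_j$ only when the test of $j$ is finished. $\mathrm{OPT}$ knows all $p_j$ in advance (but must still test $j$ in order to run it in time $p_j$), and its cost is the minimum cost of any schedule; it spends $p_j^*=\min\{u_j,t_j+p_j\}$ on job $j$ and runs jobs in non-decreasing order of $p_j^*$. The competitive ratio of an online algorithm $A$ is the smallest $c$ such that $\mathrm{cost}(A)\le c\cdot \mathrm{cost}(\mathrm{OPT})$ on all instances. Algorithm $(\alpha,\beta)$-SORT. Maintain a priority queue of tasks, smaller weight meaning higher priority (ties broken arbitrarily). Initially, for each job $j$: if $u_j\ge\alpha t_j$, insert a testing task of weight $\beta t_j$; otherwise insert an execution-untested task of weight $u_j$. While the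 queue is nonempty, extract a task of smallest weight and run it; if it was the testing task of job $j$, then after the test insert an execution task for $j$ with weight $p_j$. *)

theory Defs
  imports "HOL-Library.Extended_Real"
begin

record problem =
  num_jobs :: nat
  test_time :: "nat \<Rightarrow> real"
  upper_limit :: "nat \<Rightarrow> real"
  proc_time :: "nat \<Rightarrow> real"

definition valid_problem :: "problem \<Rightarrow> bool" where
  "valid_problem I \<longleftrightarrow>
     (\<forall>j<num_jobs I. 0 \<le> test_time I j \<and> 0 \<le> upper_limit I j \<and>
        0 \<le> proc_time I j \<and> proc_time I j \<le> upper_limit I j)"

datatype task = Test (job: nat) | Exec (job: nat) | Exec_Untested (job: nat)

fun duration :: "problem \<Rightarrow> task \<Rightarrow> real" where
  "duration I (Test j) = test_time I j"
| "duration I (Exec j) = proc_time I j"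
| "duration I (Exec_Untested j) = upper_limit I j"

text \<open>A schedule maps every task that is carried out to its starting time; idle time is allowed.\<close>

type_synonym schedule = "task \<rightharpoonup> real"

definition start :: "schedule \<Rightarrow> task \<Rightarrow> real" where
  "start S x = the (S x)"

definition finish :: "problem \<Rightarrow> schedule \<Rightarrow> task \<Rightarrow> real" where
  "finish I S x = start S x + duration I x"

definition run_untested :: "schedule \<Rightarrow> nat \<Rightarrow> bool" where
  "run_untested S j \<longleftrightarrow>
     Exec_Untested j \<in> dom S \<and> Test j \<notin> dom S \<and> Exec j \<notin> dom S"

definition run_tested :: "problem \<Rightarrow> schedule \<Rightarrow> nat \<Rightarrow> bool" where
  "run_tested I S j \<longleftrightarrow>
     Exec_Untested j \<notin> dom S \<and> Test j \<in> dom S \<and> Exec j \<in> dom S \<and>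
     finish I S (Test j) \<le> start S (Exec j)"

definition feasible :: "problem \<Rightarrow> schedule \<Rightarrow> bool" where
  "feasible I S \<longleftrightarrow>
     (\<forall>x\<in>dom S. job x < num_jobs I \<and> 0 \<le> start S x) \<and>
     (\<forall>j<num_jobs I. run_untested S j \<or> run_tested I S j) \<and>
     (\<forall>x\<in>dom S. \<forall>y\<in>dom S. x \<noteq> y \<longrightarrow> finish I S x \<le> start S y \<or> finish I S y \<le> start S x)"

definition completion_time :: "problem \<Rightarrow> schedule \<Rightarrow> nat \<Rightarrow> real" where
  "completion_time I S j =
     (if Exec_Untested j \<in> dom S then finish I S (Exec_Untested j) else finish I S (Exec j))"

definition cost :: "problem \<Rightarrow> schedule \<Rightarrow> real" where
  "cost I S = (\<Sum>j<num_jobs I. completion_time I S j)"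

definition opt_cost :: "problem \<Rightarrow> real" where
  "opt_cost I = Inf (cost I ` {S. feasible I S})"

text \<open>
  An algorithm is represented by the set of schedules it may produce on each problem instance,
  over all ways of resolving its arbitrary choices; the guarantee has to hold for all of them.
  The infimum is taken in the extended reals, so that it is \<open>\<infinity>\<close> if no finite ratio works.
\<close>

definition competitive_ratio :: "(problem \<Rightarrow> schedule set) \<Rightarrow> ereal" where
  "competitive_ratio A =
     Inf {ereal c |c. \<forall>I. valid_problem I \<longrightarrow> (\<forall>S\<in>A I. cost I S \<le> c * opt_cost I)}"

fun weight :: "problem \<Rightarrow> real \<Rightarrow> task \<Rightarrow> real" where
  "weight I \<beta> (Test j) = \<beta> * test_time I j"
| "weight I \<beta> (Exec j) = proc_time I j"
| "weight I \<beta> (Exec_Untested j) = upper_limit I j"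

definition initial_queue :: "problem \<Rightarrow> real \<Rightarrow> task set" where
  "initial_queue I \<alpha> =
     (\<lambda>j. if upper_limit I j \<ge> \<alpha> * test_time I j then Test j else Exec_Untested j)
       ` {..<num_jobs I}"

fun inserted_after :: "task \<Rightarrow> task set" where
  "inserted_after (Test j) = {Exec j}"
| "inserted_after (Exec j) = {}"
| "inserted_after (Exec_Untested j) = {}"

text \<open>
  \<open>sort_run I \<beta> Q xs\<close>: starting from the queue \<open>Q\<close>, the tasks may be run in the order \<open>xs\<close>.
  A set suffices for the queue, since no task is ever inserted twice. The value \<open>proc_time I j\<close>
  is consulted only once \<open>Exec j\<close> is in the queue, that is, after the test of \<open>j\<close>.
\<close>

inductive sort_run :: "problem \<Rightarrow> real \<Rightarrow> task set \<Rightarrow> task list \<Rightarrow> bool"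
  for I :: problem and \<beta> :: real where
  empty: "sort_run I \<beta> {} []"
| step: "x \<in> Q \<Longrightarrow> (\<forall>y\<in>Q. weight I \<beta> x \<le> weight I \<beta> y) \<Longrightarrow>
     sort_run I \<beta> ((Q - {x}) \<union> inserted_after x) xs \<Longrightarrow> sort_run I \<beta> Q (x # xs)"

fun back_to_back :: "problem \<Rightarrow> real \<Rightarrow> task list \<Rightarrow> schedule" where
  "back_to_back I s [] = Map.empty"
| "back_to_back I s (x # xs) = (back_to_back I (s + duration I x) xs)(x \<mapsto> s)"

definition sort_alg :: "real \<Rightarrow> real \<Rightarrow> problem \<Rightarrow> schedule set" where
  "sort_alg \<alpha> \<beta> I = {back_to_back I 0 xs |xs. sort_run I \<beta> (initial_queue I \<alpha>) xs}"

end

theory Submission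
  imports Defs
begin

text \<open>
  Both costs are compared pair by pair. The cost of a schedule without idle time is the sum over all ordered pairs
  \<open>(i, j)\<close> of the time spent on job \<open>i\<close> before job \<open>j\<close> completes. In a feasible schedule the
  earlier of two jobs delays the later one by at least the smaller of the optimal times
  \<open>p\<^sup>*\<close>. In a run of the algorithm, the order of the tasks of \<open>i\<close> and \<open>j\<close> is itself a run on the
  instance with these two jobs only, since extracting minima from the queue is compatible with
  deleting the other jobs. So it remains to check the few possible runs on two jobs, where the
  comparisons of weights bound the mutual delay by the claimed ratio times the smaller \<open>p\<^sup>*\<close>.
\<close>

definition opt_time :: "problem \<Rightarrow> nat \<Rightarrow> real" where
  "opt_time I j = min (upper_limit I j) (test_time I j + proc_time I j)"

lemma duration_nonneg:
  assumes "valid_problem I" "job x < num_jobs I"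
  shows "0 \<le> duration I x"
  using assms by (cases x) (auto simp: valid_problem_def)

section \<open>The cost of feasible schedules\<close>

text \<open>Induction in order of starting times. The element \<open>x\<close> starting last cannot
  precede any \<open>y\<close> of the rest, as \<open>d x > 0\<close> would make \<open>y\<close>
  start after \<open>x\<close>; so the rest ends by \<open>s x\<close>, and \<open>s x\<close> takes
  the role of \<open>T\<close>.\<close>

lemma sum_durations_le_pos:
  fixes s d :: "'a \<Rightarrow> real"
  assumes "finite X"
    and "\<And>x. x \<in> X \<Longrightarrow> 0 \<le> s x \<and> 0 < d x \<and> s x + d x \<le> T"
    and "\<And>x y. x \<in> X \<Longrightarrow> y \<in> X \<Longrightarrow> x \<noteq> y \<Longrightarrow> s x + d x \<le> s y \<or> s y + d y \<le> s x"
    and "0 \<le> T"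
  shows "sum d X \<le> T"
  using assms
proof (induction X arbitrary: T rule: finite_ranking_induct[where f = s])
  case empty
  then show ?case by simp
next
  case (insert x X)
  show ?case
  proof (cases "x \<in> X")
    \<comment> \<open>The induction rule does not exclude re-inserting an element.\<close>
    case True
    then show ?thesis using insert.IH[of T] insert.prems by (simp add: insert_absorb)
  next
    case False
    have "s y + d y \<le> s x" if "y \<in> X" for y
      using insert.prems(2)[of x y] insert.prems(1)[of x] insert.hyps(2)[OF that] that False
      by fastforce
    then have "sum d X \<le> s x"
      using insert.prems by (intro insert.IH) auto
    then show ?thesis
      using insert.prems(1)[of x] insert.hyps(1) False by simp
  qed
qed

text \<open>A task of length 0 may share its starting time with a longer one, which spoils the order
  by starting times. Such tasks add nothing to the sum and are dropped first.\<close>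

lemma sum_durations_le:
  fixes s d :: "'a \<Rightarrow> real"
  assumes "finite X"
    and "\<And>x. x \<in> X \<Longrightarrow> 0 \<le> s x \<and> 0 \<le> d x \<and> s x + d x \<le> T"
    and "\<And>x y. x \<in> X \<Longrightarrow> y \<in> X \<Longrightarrow> x \<noteq> y \<Longrightarrow> s x + d x \<le> s y \<or> s y + d y \<le> s x"
    and "0 \<le> T"
  shows "sum d X \<le> T"
proof -
  have "sum d X = sum d {x \<in> X. d x > 0}"
    using assms(1,2) by (intro sum.mono_neutral_right) force+
  also have "\<dots> \<le> T"
    using assms by (intro sum_durations_le_pos[where s = s]) auto
  finally show ?thesis .
qed

text \<open>The set is \<open>{Exec_Untested i}\<close> or \<open>{Test i, Exec i}\<close>, and
  \<open>opt_time I i\<close> is the minimum of their total durations. In the tested case,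
  \<open>proc_time I i \<ge> 0\<close> makes the test end by the completion time as well.\<close>

lemma feasible_job_tasks:
  assumes "valid_problem I" "feasible I S" "i < num_jobs I"
  obtains X where "finite X" "X \<subseteq> dom S" "\<And>x. x \<in> X \<Longrightarrow> job x = i"
    "\<And>x. x \<in> X \<Longrightarrow> finish I S x \<le> completion_time I S i"
    "opt_time I i \<le> sum (duration I) X"
proof (cases "run_untested S i")
  case True
  then show ?thesis
    by (intro that[of "{Exec_Untested i}"])
       (auto simp: run_untested_def completion_time_def opt_time_def)
next
  case False
  then have "run_tested I S i" using assms by (auto simp: feasible_def)
  moreover have "0 \<le> duration I (Exec i)" using duration_nonneg[of I "Exec i"] assms by simp
  ultimately show ?thesis
    by (intro that[of "{Test i, Exec i}"])
       (auto simp: run_tested_def completion_time_def opt_time_def finish_def)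
qed

text \<open>The tasks of all jobs counted on the left run disjointly within the interval from 0 to
  the completion time of \<open>j\<close>. The comparison is non-strict so that \<open>j\<close>
  counts itself and, of any two jobs, at least one counts towards the other.\<close>

lemma completion_time_ge:
  assumes "valid_problem I" "feasible I S" "j < num_jobs I"
  shows "(\<Sum>i<num_jobs I. if completion_time I S i \<le> completion_time I S j then opt_time I i else 0)
    \<le> completion_time I S j"
proof -
  let ?C = "completion_time I S"
  have "\<forall>i. \<exists>X. i < num_jobs I \<longrightarrow> finite X \<and> X \<subseteq> dom S \<and> (\<forall>x\<in>X. job x = i) \<and>
      (\<forall>x\<in>X. finish I S x \<le> ?C i) \<and> opt_time I i \<le> sum (duration I) X"
    by (meson feasible_job_tasks[OF assms(1,2)])
  from choice[OF this] obtain X where "\<forall>i<num_jobs I. finite (X i) \<and> X i \<subseteq> dom S \<and>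
      (\<forall>x\<in>X i. job x = i) \<and> (\<forall>x\<in>X i. finish I S x \<le> ?C i) \<and>
      opt_time I i \<le> sum (duration I) (X i)"
    by blast
  then have X: "\<And>i. i < num_jobs I \<Longrightarrow> finite (X i)"
      "\<And>i. i < num_jobs I \<Longrightarrow> X i \<subseteq> dom S" "\<And>i. i < num_jobs I \<Longrightarrow> \<forall>x\<in>X i. job x = i"
      "\<And>i. i < num_jobs I \<Longrightarrow> \<forall>x\<in>X i. finish I S x \<le> ?C i"
      "\<And>i. i < num_jobs I \<Longrightarrow> opt_time I i \<le> sum (duration I) (X i)"
    by blast+
  define J where "J = {i. i < num_jobs I \<and> ?C i \<le> ?C j}"
  have [simp]: "finite J" by (simp add: J_def)
  have C_nonneg: "0 \<le> ?C j"
  proof -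
    have "0 \<le> finish I S x" if "x \<in> dom S" for x
      proof -
      have "job x < num_jobs I" "0 \<le> start S x" using that assms(2) unfolding feasible_def by blast+
      then show ?thesis using duration_nonneg[OF assms(1)] by (simp add: finish_def)
    qed
    moreover have "run_untested S j \<or> run_tested I S j"
      using assms(2,3) unfolding feasible_def by blast
    ultimately show ?thesis
      unfolding completion_time_def run_tested_def run_untested_def by metis
  qed
  have "(\<Sum>i<num_jobs I. if ?C i \<le> ?C j then opt_time I i else 0) = (\<Sum>i\<in>J. opt_time I i)"
    by (simp add: J_def sum.If_cases Int_def)
  also have "\<dots> \<le> (\<Sum>i\<in>J. sum (duration I) (X i))"
    by (intro sum_mono X(5)) (simp add: J_def)
  also have "\<dots> = sum (duration I) (\<Union>i\<in>J. X i)"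
  proof (rule sum.UNION_disjoint[symmetric])
    show "\<forall>i\<in>J. finite (X i)" using X(1) by (simp add: J_def)
    have "job x = i" if "i \<in> J" "x \<in> X i" for i x using X(3)[of i] that by (simp add: J_def)
    then show "\<forall>i\<in>J. \<forall>k\<in>J. i \<noteq> k \<longrightarrow> X i \<inter> X k = {}" by (metis disjoint_iff)
  qed simp
  also have "\<dots> \<le> ?C j"
  proof (rule sum_durations_le[where s = "start S"])
    show "finite (\<Union>i\<in>J. X i)" using X(1) by (auto simp: J_def)
  next
    fix x assume "x \<in> (\<Union>i\<in>J. X i)"
    then obtain i where i: "i < num_jobs I" "?C i \<le> ?C j" "x \<in> X i" by (auto simp: J_def)
    have "x \<in> dom S" "finish I S x \<le> ?C i" using X(2,4)[OF i(1)] i(3) by auto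
    then show "0 \<le> start S x \<and> 0 \<le> duration I x \<and> start S x + duration I x \<le> ?C j"
      using i duration_nonneg[of I x] assms(1,2) by (auto simp: feasible_def finish_def)
  next
    fix x y assume "x \<in> (\<Union>i\<in>J. X i)" "y \<in> (\<Union>i\<in>J. X i)" "x \<noteq> y"
    moreover have "(\<Union>i\<in>J. X i) \<subseteq> dom S" using X(2) by (auto simp: J_def)
    ultimately show "start S x + duration I x \<le> start S y \<or> start S y + duration I y \<le> start S x"
      using assms(2) by (auto simp: feasible_def finish_def subset_iff)
  qed (rule C_nonneg)
  finally show ?thesis .
qed

text \<open>Makes the infimum in \<open>opt_cost\<close> one over a nonempty set. The witness runs
  all jobs untested, by increasing index and without idle time.\<close>

lemma feasible_exists:
  assumes "valid_problem I"
  shows "\<exists>S. feasible I S"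
proof -
  let ?u = "upper_limit I" and ?n = "num_jobs I"
  define S :: schedule where
    "S = (\<lambda>x. case x of Exec_Untested j \<Rightarrow> if j < ?n then Some (\<Sum>i<j. ?u i) else None | _ \<Rightarrow> None)"
  have dom: "dom S = Exec_Untested ` {..<?n}"
    by (auto simp: S_def split: task.splits if_splits)
  have start: "start S (Exec_Untested j) = (\<Sum>i<j. ?u i)" if "j < ?n" for j
    using that by (simp add: start_def S_def)
  have u: "0 \<le> ?u j" if "j < ?n" for j
    using assms that by (simp add: valid_problem_def)
  have "(\<Sum>k<i. ?u k) + ?u i \<le> (\<Sum>k<j. ?u k)" if "i < j" "j < ?n" for i j
  proof -
    have "(\<Sum>k<i. ?u k) + ?u i = (\<Sum>k<Suc i. ?u k)" by simp
    also have "\<dots> \<le> (\<Sum>k<j. ?u k)"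
      using that u by (intro sum_mono2) auto
    finally show ?thesis .
  qed
  then have "(\<Sum>k<i. ?u k) + ?u i \<le> (\<Sum>k<j. ?u k) \<or> (\<Sum>k<j. ?u k) + ?u j \<le> (\<Sum>k<i. ?u k)"
    if "i \<noteq> j" "i < ?n" "j < ?n" for i j
    using that by (metis linorder_neqE_nat)
  then have "feasible I S"
    unfolding feasible_def run_untested_def finish_def dom
    using u by (auto simp: start intro!: sum_nonneg)
  then show ?thesis by blast
qed

section \<open>Runs of the algorithm\<close>

text \<open>The share of job \<open>k\<close> in the finishing time of \<open>x\<close> when
  \<open>xs\<close> runs from time 0. Appending \<open>[x]\<close> includes the duration of
  \<open>x\<close> itself.\<close>

definition spent_until :: "problem \<Rightarrow> task list \<Rightarrow> nat \<Rightarrow> task \<Rightarrow> real" where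
  "spent_until I xs k x =
     sum_list (map (duration I) (filter (\<lambda>y. job y = k) (takeWhile (\<lambda>y. y \<noteq> x) xs @ [x])))"

lemma dom_back_to_back: "dom (back_to_back I s xs) = set xs"
  by (induction xs arbitrary: s) auto

text \<open>The map update for the head overrides later ones, so \<open>x\<close> starts at its
  first occurrence, exactly where \<open>takeWhile\<close> stops.\<close>

lemma finish_back_to_back:
  assumes "x \<in> set xs"
  shows "finish I (back_to_back I s xs) x =
    s + sum_list (map (duration I) (takeWhile (\<lambda>y. y \<noteq> x) xs @ [x]))"
  using assms
  by (induction xs arbitrary: s) (auto simp: finish_def start_def)

lemma sum_list_duration_by_job:
  assumes "\<And>y. y \<in> set ys \<Longrightarrow> job y < n"
  shows "sum_list (map (duration I) ys) =
    (\<Sum>k<n. sum_list (map (duration I) (filter (\<lambda>y. job y = k) ys)))"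
  using assms
proof (induction ys)
  case Nil
  then show ?case by simp
next
  case (Cons y ys)
  have "(\<Sum>k<n. sum_list (map (duration I) (filter (\<lambda>z. job z = k) (y # ys)))) =
      (\<Sum>k<n. (if k = job y then duration I y else 0) +
         sum_list (map (duration I) (filter (\<lambda>z. job z = k) ys)))"
    by (intro sum.cong) auto
  then show ?case using Cons by (simp add: sum.distrib)
qed

lemma finish_back_to_back_by_job:
  assumes "x \<in> set xs" "\<And>y. y \<in> set xs \<Longrightarrow> job y < n"
  shows "finish I (back_to_back I 0 xs) x = (\<Sum>k<n. spent_until I xs k x)"
proof -
  have "job y < n" if "y \<in> set (takeWhile (\<lambda>y. y \<noteq> x) xs @ [x])" for y
    using that assms by (auto dest: set_takeWhileD)
  then show ?thesis
    unfolding spent_until_def finish_back_to_back[OF assms(1)]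
    by (simp only: add_0_left sum_list_duration_by_job)
qed

section \<open>Restricting a run to a subset of the jobs\<close>

lemma filter_takeWhile_neq:
  assumes "P x"
  shows "takeWhile (\<lambda>y. y \<noteq> x) (filter P xs) = filter P (takeWhile (\<lambda>y. y \<noteq> x) xs)"
proof (induction xs)
  case (Cons y ys)
  then show ?case using assms by (cases "y = x") simp_all
qed simp

lemma spent_until_filter:
  assumes "k \<in> J" "job x \<in> J"
  shows "spent_until I (filter (\<lambda>y. job y \<in> J) xs) k x = spent_until I xs k x"
proof -
  have "(\<lambda>y. job y \<in> J \<and> job y = k) = (\<lambda>y. job y = k)" using assms(1) by auto
  then show ?thesis using assms(2) by (simp add: spent_until_def filter_takeWhile_neq)
qed

lemma job_inserted_after: "y \<in> inserted_after x \<Longrightarrow> job y = job x"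
  by (cases x) auto

lemma sort_run_jobs:
  assumes "sort_run I \<beta> Q xs" "y \<in> set xs"
  shows "job y \<in> job ` Q"
  using assms by induction (auto dest!: job_inserted_after)

text \<open>A minimum of the whole queue that belongs to \<open>J\<close> is also a minimum of the
  restricted queue. Extracting any other task leaves the restricted queue unchanged, because a task
  only triggers the insertion of a task of the same job.\<close>

lemma sort_run_filter:
  assumes "sort_run I \<beta> Q xs"
  shows "sort_run I \<beta> {x \<in> Q. job x \<in> J} (filter (\<lambda>y. job y \<in> J) xs)"
  using assms
proof induction
  case empty
  then show ?case by (simp add: sort_run.empty)
next
  case (step x Q xs)
  show ?case
  proof (cases "job x \<in> J")
    case True
    then have "{y \<in> Q - {x} \<union> inserted_after x. job y \<in> J} =
        {y \<in> Q. job y \<in> J} - {x} \<union> inserted_after x"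
      by (auto dest: job_inserted_after)
    with True step show ?thesis by (auto intro!: sort_run.step)
  next
    case False
    then have "{y \<in> Q - {x} \<union> inserted_after x. job y \<in> J} = {y \<in> Q. job y \<in> J}"
      by (auto dest: job_inserted_after)
    with False step show ?thesis by simp
  qed
qed

lemma sort_run_empty_iff: "sort_run I \<beta> {} xs \<longleftrightarrow> xs = []"
  by (auto elim: sort_run.cases intro: sort_run.empty)

text \<open>Unfolds one extraction from an explicitly listed queue, so that the simplifier can
  enumerate all runs on one or two jobs.\<close>

lemma sort_run_insert_iff:
  "sort_run I \<beta> (insert a A) xs \<longleftrightarrow>
    (\<exists>x\<in>insert a A. (\<forall>y\<in>insert a A. weight I \<beta> x \<le> weight I \<beta> y) \<and>
       (\<exists>ys. xs = x # ys \<and> sort_run I \<beta> (insert a A - {x} \<union> inserted_after x) ys))"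
  (is "?L \<longleftrightarrow> ?R")
proof
  assume ?L
  then show ?R by (cases rule: sort_run.cases) auto
next
  assume ?R
  then show ?L by (auto intro: sort_run.step)
qed

lemmas sort_run_iffs = sort_run_empty_iff sort_run_insert_iff

definition first_task :: "problem \<Rightarrow> real \<Rightarrow> nat \<Rightarrow> task" where
  "first_task I \<alpha> j = (if \<alpha> * test_time I j \<le> upper_limit I j then Test j else Exec_Untested j)"

text \<open>The task whose end completes job \<open>j\<close> in a run of the algorithm.\<close>

definition last_task :: "problem \<Rightarrow> real \<Rightarrow> nat \<Rightarrow> task" where
  "last_task I \<alpha> j = (if \<alpha> * test_time I j \<le> upper_limit I j then Exec j else Exec_Untested j)"

lemma job_first_task [simp]: "job (first_task I \<alpha> j) = j"
  by (simp add: first_task_def)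

lemma job_last_task [simp]: "job (last_task I \<alpha> j) = j"
  by (simp add: last_task_def)

lemma initial_queue_eq: "initial_queue I \<alpha> = first_task I \<alpha> ` {..<num_jobs I}"
  by (simp add: initial_queue_def first_task_def)

lemma sort_run_restrict:
  assumes "sort_run I \<beta> (initial_queue I \<alpha>) xs" "J \<subseteq> {..<num_jobs I}"
  shows "sort_run I \<beta> (first_task I \<alpha> ` J) (filter (\<lambda>y. job y \<in> J) xs)"
proof -
  have "{x \<in> initial_queue I \<alpha>. job x \<in> J} = first_task I \<alpha> ` J"
    using assms(2) by (auto simp: initial_queue_eq)
  then show ?thesis using sort_run_filter[OF assms(1), of J] by simp
qed

lemma sort_run_single:
  assumes "sort_run I \<beta> {first_task I \<alpha> j} ys"
  shows "ys = (if \<alpha> * test_time I j \<le> upper_limit I j then [Test j, Exec j] else [Exec_Untested j])"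
  using assms by (auto simp: first_task_def sort_run_iffs insert_Diff_if split: if_splits)

lemma cost_sort_run:
  assumes run: "sort_run I \<beta> (initial_queue I \<alpha>) xs"
  shows "cost I (back_to_back I 0 xs) =
    (\<Sum>j<num_jobs I. \<Sum>i<num_jobs I. spent_until I xs i (last_task I \<alpha> j))"
  unfolding cost_def
proof (rule sum.cong)
  fix j assume "j \<in> {..<num_jobs I}"
  \<comment> \<open>Restricting the run to the single job \<open>j\<close> reveals which tasks of
    \<open>j\<close> occur in \<open>xs\<close>, and hence which branch
    \<open>completion_time\<close> takes.\<close>
  then have filter: "filter (\<lambda>y. job y \<in> {j}) xs =
      (if \<alpha> * test_time I j \<le> upper_limit I j then [Test j, Exec j] else [Exec_Untested j])"
    using sort_run_restrict[OF run, of "{j}"] by (intro sort_run_single) simp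
  have mem: "y \<in> set xs \<longleftrightarrow> y \<in> set (if \<alpha> * test_time I j \<le> upper_limit I j
      then [Test j, Exec j] else [Exec_Untested j])"
    if "job y = j" for y
    using that unfolding filter[symmetric] by simp
  have last: "last_task I \<alpha> j \<in> set xs"
    and "Exec_Untested j \<in> set xs \<longleftrightarrow> \<not> \<alpha> * test_time I j \<le> upper_limit I j"
    by (simp_all add: mem last_task_def)
  then have "completion_time I (back_to_back I 0 xs) j =
      finish I (back_to_back I 0 xs) (last_task I \<alpha> j)"
    by (auto simp: completion_time_def dom_back_to_back last_task_def)
  also have "\<dots> = (\<Sum>i<num_jobs I. spent_until I xs i (last_task I \<alpha> j))"
  proof (rule finish_back_to_back_by_job[OF last])
    show "job y < num_jobs I" if "y \<in> set xs" for y
      using sort_run_jobs[OF run that] by (simp add: initial_queue_eq image_image)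
  qed
  finally show "completion_time I (back_to_back I 0 xs) j =
      (\<Sum>i<num_jobs I. spent_until I xs i (last_task I \<alpha> j))" .
qed simp

section \<open>Comparison for a pair of jobs\<close>

text \<open>Only the five lower bounds on \<open>r\<close> matter for a pair of jobs; the maximum
  itself is substituted at the very end.\<close>

context
  fixes I :: problem and \<alpha> \<beta> r :: real
  assumes valid: "valid_problem I"
    and \<alpha>: "1 \<le> \<alpha>" and \<beta>: "1 \<le> \<beta>"
    and r: "\<alpha> * (1 + 1 / \<beta>) \<le> r" "1 + 1 / \<alpha> + 1 / \<beta> \<le> r" "1 + \<beta> \<le> r" "2 \<le> r" "1 + 2 / \<alpha> \<le> r"
begin

lemma job_params:
  assumes "j < num_jobs I"
  shows "0 \<le> test_time I j" "0 \<le> upper_limit I j" "0 \<le> proc_time I j"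
    "proc_time I j \<le> upper_limit I j"
  using valid assms by (auto simp: valid_problem_def)

lemma opt_time_nonneg: "j < num_jobs I \<Longrightarrow> 0 \<le> opt_time I j"
  using job_params[of j] by (simp add: opt_time_def)

text \<open>Leaving \<open>j\<close> untested costs at most a factor \<open>\<alpha>\<close>: either
  the optimum also takes \<open>upper_limit I j\<close>, or it pays for a test longer than
  \<open>upper_limit I j / \<alpha>\<close>. The extra \<open>1 / \<beta>\<close> makes room for the
  test of another job that was run first.\<close>

lemma untested_bounds:
  assumes "j < num_jobs I" "\<not> \<alpha> * test_time I j \<le> upper_limit I j"
  shows "upper_limit I j \<le> r * opt_time I j"
    "(1 + 1 / \<beta>) * upper_limit I j \<le> r * opt_time I j"
proof -
  note p = job_params[OF assms(1)] opt_time_nonneg[OF assms(1)]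
  have "upper_limit I j \<le> \<alpha> * upper_limit I j" "0 \<le> \<alpha> * proc_time I j"
    using mult_right_mono[OF \<alpha> p(2)] p(3) \<alpha> by auto
  then have u: "upper_limit I j \<le> \<alpha> * opt_time I j"
    using assms(2) by (auto simp: opt_time_def min_def distrib_left)
  have "(1 + 1 / \<beta>) * upper_limit I j \<le> (1 + 1 / \<beta>) * (\<alpha> * opt_time I j)"
    using u \<beta> by (intro mult_left_mono) auto
  also have "\<dots> = \<alpha> * (1 + 1 / \<beta>) * opt_time I j" by simp
  also have "\<dots> \<le> r * opt_time I j" using r(1) p(5) by (rule mult_right_mono)
  finally show b: "(1 + 1 / \<beta>) * upper_limit I j \<le> r * opt_time I j" .
  have "0 \<le> upper_limit I j / \<beta>" using p \<beta> by simp
  with b show "upper_limit I j \<le> r * opt_time I j" by (simp add: distrib_right)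
qed

text \<open>The left-hand sides are the worst delays arising in the runs on two jobs below. Each is
  compared with both candidates for \<open>opt_time I j\<close>, using
  \<open>test_time I j \<le> upper_limit I j / \<alpha>\<close>.\<close>

lemma tested_bounds:
  assumes "j < num_jobs I" "\<alpha> * test_time I j \<le> upper_limit I j"
  shows "\<beta> * test_time I j + test_time I j \<le> r * opt_time I j"
    "2 * test_time I j + proc_time I j \<le> r * opt_time I j"
    "test_time I j + proc_time I j + proc_time I j / \<beta> \<le> r * opt_time I j"
proof -
  let ?t = "test_time I j" and ?u = "upper_limit I j" and ?p = "proc_time I j"
  note p = job_params[OF assms(1)]
  have tu: "?t \<le> ?u / \<alpha>" using assms(2) \<alpha> by (simp add: field_simps)
  have "?u / \<alpha> \<le> ?u" using \<alpha> p(2) by (simp add: divide_le_eq mult_left_mono[of 1 \<alpha> ?u, simplified])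
  with tu have "?t \<le> opt_time I j" using p by (simp add: opt_time_def)
  then have "(1 + \<beta>) * ?t \<le> r * opt_time I j" using r(3) \<beta> p by (intro mult_mono) auto
  then show "\<beta> * ?t + ?t \<le> r * opt_time I j" by (simp add: algebra_simps)
  have pb: "?p / \<beta> \<le> ?u / \<beta>" using p \<beta> by (simp add: divide_right_mono)
  have pb': "?p / \<beta> \<le> (?t + ?p) / \<beta>" using p \<beta> by (simp add: divide_right_mono)
  \<comment> \<open>The first two inequalities serve the case where \<open>opt_time I j\<close> is
    \<open>?u\<close>; the third one and the one stated next serve the case
    \<open>?t + ?p\<close>.\<close>
  have "(1 + 2 / \<alpha>) * ?u \<le> r * ?u" "(1 + 1 / \<alpha> + 1 / \<beta>) * ?u \<le> r * ?u"
    "2 * (?t + ?p) \<le> r * (?t + ?p)"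
    by (intro mult_right_mono r; use p in simp)+
  moreover have "(1 + 1 / \<beta>) * (?t + ?p) \<le> r * (?t + ?p)"
    using r(2) \<alpha> p by (intro mult_right_mono) (auto intro: order_trans[rotated])
  ultimately show "2 * ?t + ?p \<le> r * opt_time I j" "?t + ?p + ?p / \<beta> \<le> r * opt_time I j"
    using tu p pb pb' by (auto simp: opt_time_def min_def distrib_right)
qed

lemma le_r_minI: "x \<le> r * a \<Longrightarrow> x \<le> r * b \<Longrightarrow> x \<le> r * min a b"
  by (simp add: min_def)

lemma le_div_\<beta>: "\<beta> * x \<le> y \<Longrightarrow> x \<le> y / \<beta>"
  using \<beta> by (simp add: field_simps)

abbreviation mutual_delay :: "task list \<Rightarrow> nat \<Rightarrow> nat \<Rightarrow> real" where
  "mutual_delay ys i j \<equiv>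
     spent_until I ys i (last_task I \<alpha> j) + spent_until I ys j (last_task I \<alpha> i)"

text \<open>\<open>Test i\<close> has already run, so
  \<open>test_time I i \<le> test_time I j\<close>. The later extractions compare
  \<open>proc_time I i\<close> with \<open>\<beta> * test_time I j\<close>, and then the two
  processing times; this lets the delay be rewritten in the parameters of either job alone.\<close>

lemma mutual_delay_both_tested:
  assumes ij: "i < num_jobs I" "j < num_jobs I" "i \<noteq> j"
    and tested: "\<alpha> * test_time I i \<le> upper_limit I i" "\<alpha> * test_time I j \<le> upper_limit I j"
    and le: "\<beta> * test_time I i \<le> \<beta> * test_time I j"
    and run: "sort_run I \<beta> {Exec i, Test j} ys"
  shows "mutual_delay (Test i # ys) i j \<le> r * min (opt_time I i) (opt_time I j)"
proof -
  note p = job_params[OF ij(1)] job_params[OF ij(2)]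
    and b = tested_bounds[OF ij(1) tested(1)] tested_bounds[OF ij(2) tested(2)]
  have t: "test_time I i \<le> test_time I j" using le \<beta> by simp
  consider "ys = [Exec i, Test j, Exec j]" "proc_time I i \<le> \<beta> * test_time I j"
    | "ys = [Test j, Exec i, Exec j]" "test_time I j \<le> proc_time I i / \<beta>"
        "proc_time I i \<le> proc_time I j"
    | "ys = [Test j, Exec j, Exec i]" "test_time I j \<le> proc_time I i / \<beta>"
        "proc_time I j \<le> proc_time I i"
    using run ij(3) by (auto simp: sort_run_iffs insert_Diff_if dest: le_div_\<beta>)
  then show ?thesis
    by cases (use ij(3) tested p b t in
      \<open>auto simp: last_task_def spent_until_def intro!: le_r_minI\<close>)
qed

lemma mutual_delay_one_tested:
  assumes ij: "i < num_jobs I" "j < num_jobs I" "i \<noteq> j"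
    and tested: "\<alpha> * test_time I i \<le> upper_limit I i" "\<not> \<alpha> * test_time I j \<le> upper_limit I j"
    and run: "sort_run I \<beta> {Test i, Exec_Untested j} ys"
  shows "mutual_delay ys i j \<le> r * min (opt_time I i) (opt_time I j)"
proof -
  note p = job_params[OF ij(1)] job_params[OF ij(2)]
    and b = tested_bounds[OF ij(1) tested(1)] untested_bounds[OF ij(2) tested(2)]
  have b': "upper_limit I j + upper_limit I j / \<beta> \<le> r * opt_time I j"
    using b(5) by (simp add: distrib_right)
  have pb: "0 \<le> proc_time I i / \<beta>" using p \<beta> by simp
  \<comment> \<open>The delays are \<open>upper_limit I j\<close>, then
    \<open>test_time I i + proc_time I i\<close>, then
    \<open>test_time I i + upper_limit I j\<close>. In the last two cases
    \<open>(1 + 1 / \<beta>) * upper_limit I j\<close> dominates.\<close>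
  consider "ys = [Exec_Untested j, Test i, Exec i]" "upper_limit I j \<le> \<beta> * test_time I i"
    | "ys = [Test i, Exec i, Exec_Untested j]" "test_time I i \<le> upper_limit I j / \<beta>"
        "proc_time I i \<le> upper_limit I j"
    | "ys = [Test i, Exec_Untested j, Exec i]" "test_time I i \<le> upper_limit I j / \<beta>"
        "upper_limit I j \<le> proc_time I i"
    using run ij(3) by (auto simp: sort_run_iffs insert_Diff_if dest: le_div_\<beta>)
  then show ?thesis
    by cases (use ij(3) tested p pb b b' in
      \<open>auto simp: last_task_def spent_until_def intro!: le_r_minI\<close>)
qed

text \<open>The delay is the smaller upper limit, which is within the factor \<open>r\<close> of the
  optimal time of either job.\<close>

lemma mutual_delay_untested:
  assumes ij: "i < num_jobs I" "j < num_jobs I" "i \<noteq> j"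
    and untested: "\<not> \<alpha> * test_time I i \<le> upper_limit I i"
      "\<not> \<alpha> * test_time I j \<le> upper_limit I j"
    and run: "sort_run I \<beta> {Exec_Untested i, Exec_Untested j} ys"
  shows "mutual_delay ys i j \<le> r * min (opt_time I i) (opt_time I j)"
proof -
  note b = untested_bounds[OF ij(1) untested(1)] untested_bounds[OF ij(2) untested(2)]
  consider "ys = [Exec_Untested i, Exec_Untested j]" "upper_limit I i \<le> upper_limit I j"
    | "ys = [Exec_Untested j, Exec_Untested i]" "upper_limit I j \<le> upper_limit I i"
    using run ij(3) by (auto simp: sort_run_iffs insert_Diff_if)
  then show ?thesis
    by cases (use ij(3) untested b in
      \<open>auto simp: last_task_def spent_until_def intro!: le_r_minI\<close>)
qed

lemma mutual_delay_le:
  assumes ij: "i < num_jobs I" "j < num_jobs I" "i \<noteq> j"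
    and run: "sort_run I \<beta> {first_task I \<alpha> i, first_task I \<alpha> j} ys"
  shows "mutual_delay ys i j \<le> r * min (opt_time I i) (opt_time I j)"
proof -
  have comm: "mutual_delay ys j i \<le> r * min (opt_time I j) (opt_time I i) \<Longrightarrow> ?thesis"
    by (simp add: min.commute add.commute)
  consider "\<alpha> * test_time I i \<le> upper_limit I i" "\<alpha> * test_time I j \<le> upper_limit I j"
    | "\<alpha> * test_time I i \<le> upper_limit I i" "\<not> \<alpha> * test_time I j \<le> upper_limit I j"
    | "\<not> \<alpha> * test_time I i \<le> upper_limit I i" "\<alpha> * test_time I j \<le> upper_limit I j"
    | "\<not> \<alpha> * test_time I i \<le> upper_limit I i" "\<not> \<alpha> * test_time I j \<le> upper_limit I j"
    by blast
  then show ?thesis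
  proof cases
    case 1
    then have "sort_run I \<beta> {Test i, Test j} ys" using run by (simp add: first_task_def)
    \<comment> \<open>The test of smaller weight comes first. If it is that of \<open>j\<close>, the
      roles are swapped through \<open>comm\<close>, as the mutual delay is symmetric.\<close>
    then consider zs where "ys = Test i # zs" "\<beta> * test_time I i \<le> \<beta> * test_time I j"
        "sort_run I \<beta> {Exec i, Test j} zs"
      | zs where "ys = Test j # zs" "\<beta> * test_time I j \<le> \<beta> * test_time I i"
        "sort_run I \<beta> {Exec j, Test i} zs"
      using ij(3)
      by (subst (asm) sort_run_insert_iff) (auto simp: insert_Diff_if insert_commute)
    then show ?thesis
      using mutual_delay_both_tested[OF ij 1] comm
        mutual_delay_both_tested[OF ij(2,1) ij(3)[symmetric] 1(2,1)]
      by cases auto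
  next
    case 2
    then show ?thesis
      using run by (intro mutual_delay_one_tested ij) (simp_all add: first_task_def)
  next
    case 3
    then show ?thesis
      using run ij by (intro comm mutual_delay_one_tested)
        (simp_all add: first_task_def insert_commute)
  next
    case 4
    then show ?thesis
      using run by (intro mutual_delay_untested ij) (simp_all add: first_task_def)
  qed
qed

lemma spent_until_self_le:
  assumes j: "j < num_jobs I"
    and run: "sort_run I \<beta> {first_task I \<alpha> j} ys"
  shows "spent_until I ys j (last_task I \<alpha> j) \<le> r * opt_time I j"
proof (cases "\<alpha> * test_time I j \<le> upper_limit I j")
  case True
  have "ys = [Test j, Exec j]" using sort_run_single[OF run] True by simp
  with True show ?thesis
    using tested_bounds(2)[OF j True] job_params[OF j]
    by (simp add: last_task_def spent_until_def)
next
  case False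
  have "ys = [Exec_Untested j]" using sort_run_single[OF run] False by simp
  with False show ?thesis
    using untested_bounds(1)[OF j False] by (simp add: last_task_def spent_until_def)
qed

text \<open>\<open>C\<close> stands for the completion times of a competing schedule. At least one
  of the two conditions on \<open>C\<close> holds, so the bracket is at least the smaller optimal
  time; for \<open>i = j\<close> both sides are twice the term of a single job.\<close>

lemma spent_until_add_le:
  fixes C :: "nat \<Rightarrow> real"
  assumes ij: "i < num_jobs I" "j < num_jobs I"
    and run: "sort_run I \<beta> (initial_queue I \<alpha>) xs"
  shows "mutual_delay xs i j \<le>
    r * ((if C i \<le> C j then opt_time I i else 0) + (if C j \<le> C i then opt_time I j else 0))"
proof -
  have r0: "0 \<le> r" using r(4) by simp
  show ?thesis
  proof (cases "i = j")
    case True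
    have "sort_run I \<beta> {first_task I \<alpha> i} (filter (\<lambda>y. job y \<in> {i}) xs)"
      using sort_run_restrict[OF run, of "{i}"] ij by simp
    then have "spent_until I xs i (last_task I \<alpha> i) \<le> r * opt_time I i"
      using spent_until_self_le[OF ij(1)] spent_until_filter[of i "{i}"] by (metis job_last_task singletonI)
    with True show ?thesis by (simp add: distrib_left)
  next
    case False
    have run_ij: "sort_run I \<beta> {first_task I \<alpha> i, first_task I \<alpha> j} (filter (\<lambda>y. job y \<in> {i, j}) xs)"
      using sort_run_restrict[OF run, of "{i, j}"] ij by simp
    have "mutual_delay xs i j \<le> r * min (opt_time I i) (opt_time I j)"
      using mutual_delay_le[OF ij False run_ij] by (simp only: spent_until_filter insertI1 insertI2 job_last_task)
    also have "\<dots> \<le> r * ((if C i \<le> C j then opt_time I i else 0) + (if C j \<le> C i then opt_time I j else 0))"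
      using r0 opt_time_nonneg[OF ij(1)] opt_time_nonneg[OF ij(2)]
      by (intro mult_left_mono) auto
    finally show ?thesis .
  qed
qed

end

section \<open>Summing over all pairs of jobs and bounding the ratio\<close>

lemma sum_sum_le_by_pairs:
  fixes f g :: "nat \<Rightarrow> nat \<Rightarrow> real"
  assumes "\<And>i j. i \<in> A \<Longrightarrow> j \<in> A \<Longrightarrow> f i j + f j i \<le> g i j + g j i"
  shows "(\<Sum>j\<in>A. \<Sum>i\<in>A. f i j) \<le> (\<Sum>j\<in>A. \<Sum>i\<in>A. g i j)"
proof -
  \<comment> \<open>Adding the transposed sum doubles the total. A termwise bound could fail, since
    the algorithm may order a pair of jobs differently from the competing schedule.\<close>
  have double: "(\<Sum>j\<in>A. \<Sum>i\<in>A. h i j + h j i) = 2 * (\<Sum>j\<in>A. \<Sum>i\<in>A. h i j)"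
    for h :: "nat \<Rightarrow> nat \<Rightarrow> real"
    using sum.swap[of h A A] by (simp add: sum.distrib)
  have "(\<Sum>j\<in>A. \<Sum>i\<in>A. f i j + f j i) \<le> (\<Sum>j\<in>A. \<Sum>i\<in>A. g i j + g j i)"
    using assms by (intro sum_mono)
  then show ?thesis unfolding double by simp
qed

theorem theorem3:
  fixes \<alpha> \<beta> :: real
  assumes "\<alpha> \<ge> 1" and "\<beta> \<ge> 1"
  shows "competitive_ratio (sort_alg \<alpha> \<beta>) \<le>
    ereal (Max {\<alpha> * (1 + 1 / \<beta>), 1 + 1 / \<alpha> + 1 / \<beta>, 1 + \<beta>, 2, 1 + 2 / \<alpha>})"
proof -
  define r where "r = Max {\<alpha> * (1 + 1 / \<beta>), 1 + 1 / \<alpha> + 1 / \<beta>, 1 + \<beta>, 2, 1 + 2 / \<alpha>}"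
  have r: "\<alpha> * (1 + 1 / \<beta>) \<le> r" "1 + 1 / \<alpha> + 1 / \<beta> \<le> r" "1 + \<beta> \<le> r" "2 \<le> r" "1 + 2 / \<alpha> \<le> r"
    unfolding r_def by (rule Max_ge; simp)+
  have "cost I S \<le> r * opt_cost I" if valid: "valid_problem I" and "S \<in> sort_alg \<alpha> \<beta> I" for I S
  proof -
    obtain xs where S: "S = back_to_back I 0 xs" and run: "sort_run I \<beta> (initial_queue I \<alpha>) xs"
      using \<open>S \<in> sort_alg \<alpha> \<beta> I\<close> by (auto simp: sort_alg_def)
    \<comment> \<open>Dividing by \<open>r > 0\<close> gives a lower bound on every feasible cost,
      which passes to the infimum.\<close>
    have "cost I S / r \<le> cost I S'" if S': "feasible I S'" for S'
    proof -
      let ?C = "completion_time I S'"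
      have "cost I S \<le> (\<Sum>j<num_jobs I. \<Sum>i<num_jobs I. r * (if ?C i \<le> ?C j then opt_time I i else 0))"
        unfolding S cost_sort_run[OF run]
        using spent_until_add_le[OF valid assms r _ _ run, of _ _ ?C]
        by (intro sum_sum_le_by_pairs) (simp only: lessThan_iff distrib_left)
      also have "\<dots> \<le> r * cost I S'"
        using r(4) completion_time_ge[OF valid S'] unfolding cost_def sum_distrib_left[symmetric]
        by (intro mult_left_mono sum_mono) auto
      finally show ?thesis using r(4) by (simp add: divide_le_eq mult.commute)
    qed
    then have "cost I S / r \<le> opt_cost I"
      unfolding opt_cost_def using feasible_exists[OF valid] by (intro cInf_greatest) auto
    then show ?thesis using r(4) by (simp add: divide_le_eq mult.commute)
  qed
  then show ?thesis
    unfolding competitive_ratio_def r_def[symmetric] by (intro Inf_lower) blast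
qed

end
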